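(* Let $E$ and $F$ be Banach lattices and let $S,T\colon E\to F$ be two operators such that $T$ dominates $S$ and $S$ is d-compact. Then $\chi(S)\le\chi(T)$.
   Context: Banach lattices are complex unless specified otherwise; operators are linear and bounded. $T$ dominates $S$ if $|Sx|\le T|x|$ for every $x\in E$. A net $(x_\alpha)$ in a Banach lattice $E$ d-converges to $x\in E$ if $\||x_\alpha-x|\wedge y\|\to0$ for every $y\in E_+$. The topology generated by this convergence is the d-topology of $E$ (a base of neighbourhoods of $0$ is given by finite intersections of the sets $\{x\in E:\||x|\wedge y\|<\varepsilon\}$, $y\in E_+$, $\varepsilon>0$). A set is relatively d-compact if it is relatively compact with respect to the d-topology. An operator between Banach lattices is d-compact if it maps bounded sets into relatively d-compact sets. For a bounded subset $A$ of a Banach space, $\chi(A)=\inf\{\delta>0 : A \text{ can be covered by finitely many balls of radius }\delta\}$; for an operator $T\colon E\to F$, $\chi(T)=\chi(TB_E)$, where $B_E$ is the unit ball of $E$. *)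

theory Defs
  imports "HOL-Analysis.Analysis" "HOL-Library.Lattice_Algebras"
begin

class banach_lattice = banach + ordered_real_vector + lattice_ab_group_add_abs +
  assumes norm_mono_abs: "\<bar>x\<bar> \<le> \<bar>y\<bar> \<Longrightarrow> norm x \<le> norm y"

lemma abs_real_eq_sup: "\<bar>x\<bar> = sup x (- x)" for x :: real
  by (simp add: sup_real_def)

instance real :: banach_lattice
  by standard (simp_all add: abs_real_eq_sup[symmetric])

lemma norm_abs_lattice [simp]: "norm \<bar>x\<bar> = norm x" for x :: "'a::banach_lattice"
  by (intro antisym norm_mono_abs) simp_all

lemma norm_mono_nonneg: "0 \<le> x \<Longrightarrow> x \<le> y \<Longrightarrow> norm x \<le> norm y" for x y :: "'a::banach_lattice"
  by (rule norm_mono_abs) (metis abs_of_nonneg order_trans)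

lemma scaleR_le_abs: "r *\<^sub>R x \<le> \<bar>r\<bar> *\<^sub>R \<bar>x\<bar>" for x :: "'a::banach_lattice"
proof (cases "r \<ge> 0")
  case True
  then show ?thesis by (simp add: scaleR_left_mono abs_ge_self)
next
  case False
  then have "\<bar>r\<bar> *\<^sub>R (- x) \<le> \<bar>r\<bar> *\<^sub>R \<bar>x\<bar>"
    by (intro scaleR_left_mono abs_ge_minus_self) auto
  then show ?thesis using False by simp
qed

lemma nonneg_limit:
  fixes a :: "'a::banach_lattice"
  assumes lim: "X \<longlonglongrightarrow> a" and pos: "\<And>n. 0 \<le> X n"
  shows "0 \<le> a"
proof -
  have b: "norm (sup (- a) 0) \<le> norm (X n - a)" for n
  proof -
    have "- a \<le> X n - a" using pos[of n] by simp
    also have "\<dots> \<le> \<bar>X n - a\<bar>" by (rule abs_ge_self)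
    finally have "sup (- a) 0 \<le> \<bar>X n - a\<bar>" by simp
    then have "norm (sup (- a) 0) \<le> norm \<bar>X n - a\<bar>" by (intro norm_mono_nonneg) simp_all
    then show ?thesis by simp
  qed
  have "(\<lambda>n. norm (X n - a)) \<longlonglongrightarrow> 0"
    using lim by (simp add: LIM_zero_iff tendsto_norm_zero_iff)
  then have "norm (sup (- a) 0) \<le> 0"
    using b by (intro LIMSEQ_le_const) auto
  then have "sup (- a) 0 = 0" by simp
  then show ?thesis by (metis neg_le_0_iff_le sup.orderI sup.commute)
qed

lemma le_limit:
  fixes a b :: "'a::banach_lattice"
  assumes "X \<longlonglongrightarrow> a" "Y \<longlonglongrightarrow> b" "\<And>n. X n \<le> Y n"
  shows "a \<le> b"
  using nonneg_limit[OF tendsto_diff[OF assms(2,1)]] assms(3) by simp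

text \<open>A complex Banach lattice is the complexification \<open>E \<oplus> iE\<close> of a real Banach lattice \<open>E\<close>,
  normed by \<open>\<parallel>z\<parallel> = \<parallel>|z|\<parallel>\<close> where \<open>|z|\<close> is the modulus defined below. The modulus is taken as an
  element of the real part; \<open>complexify\<close> embeds the real part into the complexification.\<close>

datatype 'a complexification = Cplx (re_part: 'a) (im_part: 'a)

lemma cplx_eqI: "re_part z = re_part w \<Longrightarrow> im_part z = im_part w \<Longrightarrow> z = w"
  by (cases z; cases w) simp

abbreviation complexify :: "'a::zero \<Rightarrow> 'a complexification" where
  "complexify x \<equiv> Cplx x 0"

instantiation complexification :: (ab_group_add) ab_group_add
begin
definition "0 = Cplx 0 0"
definition "z + w = Cplx (re_part z + re_part w) (im_part z + im_part w)"
definition "z - w = Cplx (re_part z - re_part w) (im_part z - im_part w)"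
definition "- z = Cplx (- re_part z) (- im_part z)"
instance
  by standard (simp_all add: zero_complexification_def plus_complexification_def
      minus_complexification_def uminus_complexification_def algebra_simps)
end

lemma re_im_simps [simp]:
  "re_part 0 = 0" "im_part 0 = 0"
  "re_part (z + w) = re_part z + re_part w" "im_part (z + w) = im_part z + im_part w"
  "re_part (z - w) = re_part z - re_part w" "im_part (z - w) = im_part z - im_part w"
  "re_part (- z) = - re_part z" "im_part (- z) = - im_part z"
  by (simp_all add: zero_complexification_def plus_complexification_def
      minus_complexification_def uminus_complexification_def)

instantiation complexification :: (real_vector) real_vector
begin
definition "r *\<^sub>R z = Cplx (r *\<^sub>R re_part z) (r *\<^sub>R im_part z)" for z :: "'a complexification"
instance
  by standard (auto intro!: cplx_eqI simp: scaleR_complexification_def algebra_simps)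
end

definition cscale :: "complex \<Rightarrow> 'a::real_vector complexification \<Rightarrow> 'a complexification" where
  "cscale c z = Cplx (Re c *\<^sub>R re_part z - Im c *\<^sub>R im_part z)
                     (Re c *\<^sub>R im_part z + Im c *\<^sub>R re_part z)"

lemma re_im_cscale [simp]:
  "re_part (cscale c z) = Re c *\<^sub>R re_part z - Im c *\<^sub>R im_part z"
  "im_part (cscale c z) = Re c *\<^sub>R im_part z + Im c *\<^sub>R re_part z"
  by (simp_all add: cscale_def)

lemma scaleR_complexification_eq_cscale: "r *\<^sub>R z = cscale (of_real r) z"
  for z :: "'a::real_vector complexification"
  by (simp add: scaleR_complexification_def cscale_def)

lemma vector_space_cscale: "vector_space (cscale :: complex \<Rightarrow> 'a::real_vector complexification \<Rightarrow> _)"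
  by standard (auto intro!: cplx_eqI simp: algebra_simps)

lemma cscale_cscale: "cscale a (cscale b z) = cscale (a * b) z"
  by (auto intro!: cplx_eqI simp: algebra_simps)

lemma cscale_one [simp]: "cscale 1 z = z"
  by (auto intro!: cplx_eqI)

text \<open>This order is the one whose positive cone is the positive cone of the real part.\<close>

instantiation complexification :: (ordered_ab_group_add) order
begin
definition "z \<le> w \<longleftrightarrow> im_part z = im_part w \<and> re_part z \<le> re_part w"
definition "z < w \<longleftrightarrow> im_part z = im_part w \<and> re_part z < re_part w"
instance
  by standard (auto simp: less_eq_complexification_def less_complexification_def intro: cplx_eqI)
end

definition is_modulus :: "'a::banach_lattice complexification \<Rightarrow> 'a \<Rightarrow> bool" where
  "is_modulus z m \<longleftrightarrow>
     (\<forall>t. re_part (cscale (cis t) z) \<le> m) \<and>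
     (\<forall>u. (\<forall>t. re_part (cscale (cis t) z) \<le> u) \<longrightarrow> m \<le> u)"

text \<open>The modulus is the supremum of the real parts of all rotations \<open>cscale (cis t) z\<close>;
  lemma \<open>is_modulus_modulus\<close> below shows that this supremum always exists.\<close>

definition modulus :: "'a::banach_lattice complexification \<Rightarrow> 'a" where
  "modulus z = (THE m. is_modulus z m)"

lemma cos_lipschitz: "\<bar>cos s - cos t\<bar> \<le> \<bar>s - t\<bar>" for s t :: real
proof -
  have "\<bar>cos s - cos t\<bar> = 2 * (\<bar>sin ((s + t) / 2)\<bar> * \<bar>sin ((t - s) / 2)\<bar>)"
    by (simp add: cos_diff_cos abs_mult)
  also have "\<dots> \<le> 2 * (1 * \<bar>(t - s) / 2\<bar>)"
    by (intro mult_left_mono mult_mono abs_sin_le_one abs_sin_x_le_abs_x) auto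
  finally show ?thesis by simp
qed

lemma sin_lipschitz: "\<bar>sin s - sin t\<bar> \<le> \<bar>s - t\<bar>" for s t :: real
  using cos_lipschitz[of "pi/2 - s" "pi/2 - t"] by (simp add: cos_diff)

lemma rotation_lipschitz:
  fixes z :: "'a::banach_lattice complexification"
  shows "re_part (cscale (cis s) z) \<le>
    re_part (cscale (cis t) z) + \<bar>s - t\<bar> *\<^sub>R (\<bar>re_part z\<bar> + \<bar>im_part z\<bar>)"
proof -
  have "(cos s - cos t) *\<^sub>R re_part z \<le> \<bar>cos s - cos t\<bar> *\<^sub>R \<bar>re_part z\<bar>"
    by (rule scaleR_le_abs)
  also have "\<dots> \<le> \<bar>s - t\<bar> *\<^sub>R \<bar>re_part z\<bar>"
    by (intro scaleR_right_mono cos_lipschitz) auto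
  finally have 1: "(cos s - cos t) *\<^sub>R re_part z \<le> \<bar>s - t\<bar> *\<^sub>R \<bar>re_part z\<bar>" .
  have "(sin t - sin s) *\<^sub>R im_part z \<le> \<bar>sin t - sin s\<bar> *\<^sub>R \<bar>im_part z\<bar>"
    by (rule scaleR_le_abs)
  also have "\<dots> \<le> \<bar>s - t\<bar> *\<^sub>R \<bar>im_part z\<bar>"
    using sin_lipschitz[of t s] by (intro scaleR_right_mono) (auto simp: abs_minus_commute)
  finally have 2: "(sin t - sin s) *\<^sub>R im_part z \<le> \<bar>s - t\<bar> *\<^sub>R \<bar>im_part z\<bar>" .
  show ?thesis
    using add_mono[OF 1 2] by (simp add: algebra_simps)
qed

lemma grid_point_near:
  fixes t :: real
  assumes "0 \<le> t" "t \<le> 7"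
  shows "\<exists>k \<le> 7 * Suc n. \<bar>t - real k / real (Suc n)\<bar> \<le> 1 / real (Suc n)"
proof -
  define k where "k = nat \<lfloor>t * real (Suc n)\<rfloor>"
  have nn: "0 \<le> t * real (Suc n)" using assms(1) by simp
  have k: "real k = of_int \<lfloor>t * real (Suc n)\<rfloor>" using nn by (simp add: k_def)
  have le: "real k \<le> t * real (Suc n)" "t * real (Suc n) \<le> real k + 1"
    unfolding k by linarith+
  have "t * real (Suc n) \<le> 7 * real (Suc n)" using assms(2) by (intro mult_right_mono) auto
  then have "real k \<le> real (7 * Suc n)" using le(1) by simp
  then have "k \<le> 7 * Suc n" by (simp only: of_nat_le_iff)
  moreover have "t - real k / real (Suc n) = (t * real (Suc n) - real k) / real (Suc n)"
    by (simp add: field_simps)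
  then have "\<bar>t - real k / real (Suc n)\<bar> \<le> 1 / real (Suc n)"
    using le by (simp add: divide_right_mono)
  ultimately show ?thesis by blast
qed

lemma is_modulus_exists:
  fixes z :: "'a::banach_lattice complexification"
  shows "\<exists>m. is_modulus z m"
proof -
  define f where "f t = re_part (cscale (cis t) z)" for t
  define u where "u = \<bar>re_part z\<bar> + \<bar>im_part z\<bar>"
  have u0: "0 \<le> u" by (simp add: u_def)
  define G where "G n = (\<lambda>k. real k / real (Suc n)) ` {..7 * Suc n}" for n
  define s where "s n = Sup_fin (f ` G n)" for n
  have fG: "finite (f ` G n)" "f ` G n \<noteq> {}" for n by (auto simp: G_def)
  have f_le: "f t \<le> s n + (1 / real (Suc n)) *\<^sub>R u" for t n
  proof -
    define j where "j = \<lfloor>t / (2 * pi)\<rfloor>"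
    define t' where "t' = t - 2 * pi * of_int j"
    have "0 \<le> t'"
    proof -
      have "of_int j \<le> t / (2 * pi)" by (simp add: j_def)
      then show ?thesis by (simp add: t'_def field_simps)
    qed
    moreover have "t' \<le> 7"
    proof -
      have "t / (2 * pi) \<le> of_int j + 1" unfolding j_def by linarith
      then have "t' \<le> 2 * pi" by (simp add: t'_def field_simps)
      then show ?thesis using pi_less_4 pi_approx(2) by simp
    qed
    ultimately obtain k where k: "k \<le> 7 * Suc n" "\<bar>t' - real k / real (Suc n)\<bar> \<le> 1 / real (Suc n)"
      using grid_point_near by blast
    have "cis t = cis t' * cis (2 * pi * of_int j)" by (simp only: cis_mult t'_def diff_add_cancel)
    also have "cis (2 * pi * of_int j) = 1" by (intro cis_multiple_2pi) simp
    finally have "cis t = cis t'" by simp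
    then have "f t = f t'" by (simp add: f_def)
    also have "\<dots> \<le> f (real k / real (Suc n)) + \<bar>t' - real k / real (Suc n)\<bar> *\<^sub>R u"
      unfolding f_def u_def by (rule rotation_lipschitz)
    also have "\<dots> \<le> s n + (1 / real (Suc n)) *\<^sub>R u"
      unfolding s_def using k u0 fG
      by (intro add_mono scaleR_right_mono Sup_fin.coboundedI) (auto simp: G_def)
    finally show ?thesis .
  qed
  have s_le: "s m \<le> s n + (1 / real (Suc n)) *\<^sub>R u" for m n
    unfolding s_def[of m] using fG f_le by (intro Sup_fin.boundedI) auto
  have diff: "norm (s m - s n) \<le> (1 / real (Suc N)) * norm u" if "N \<le> m" "N \<le> n" for m n N
  proof -
    have N: "(1 / real (Suc k)) *\<^sub>R u \<le> (1 / real (Suc N)) *\<^sub>R u" if "N \<le> k" for k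
      using u0 that by (intro scaleR_right_mono) (auto simp: field_simps)
    have "s m - s n \<le> (1 / real (Suc N)) *\<^sub>R u"
      using order_trans[OF s_le[of m n] add_left_mono[OF N[OF that(2)]]] by (simp add: algebra_simps)
    moreover have "- (s m - s n) \<le> (1 / real (Suc N)) *\<^sub>R u"
      using order_trans[OF s_le[of n m] add_left_mono[OF N[OF that(1)]]] by (simp add: algebra_simps)
    ultimately have "\<bar>s m - s n\<bar> \<le> (1 / real (Suc N)) *\<^sub>R u" by (rule abs_leI)
    then have "norm \<bar>s m - s n\<bar> \<le> norm ((1 / real (Suc N)) *\<^sub>R u)"
      by (intro norm_mono_nonneg) auto
    then show ?thesis by simp
  qed
  have null: "(\<lambda>n. 1 / real (Suc n)) \<longlonglongrightarrow> 0"
    using LIMSEQ_inverse_real_of_nat by (simp add: inverse_eq_divide)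
  have "Cauchy s"
  proof (rule metric_CauchyI)
    fix e :: real assume "0 < e"
    have "(\<lambda>n. (1 / real (Suc n)) * norm u) \<longlonglongrightarrow> 0 * norm u"
      by (intro tendsto_mult null tendsto_const)
    then have "eventually (\<lambda>n. (1 / real (Suc n)) * norm u < e) sequentially"
      using \<open>0 < e\<close> order_tendstoD(2) by fastforce
    then obtain N where "(1 / real (Suc N)) * norm u < e"
      by (auto simp: eventually_sequentially)
    then show "\<exists>M. \<forall>m\<ge>M. \<forall>n\<ge>M. dist (s m) (s n) < e"
      using diff by (auto simp: dist_norm intro!: exI[of _ N] elim: le_less_trans[rotated])
  qed
  then obtain l where l: "s \<longlonglongrightarrow> l" by (auto simp: Cauchy_convergent_iff convergent_def)
  have "f t \<le> l" for t
  proof -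
    have "(\<lambda>n. s n + (1 / real (Suc n)) *\<^sub>R u) \<longlonglongrightarrow> l + 0 *\<^sub>R u"
      by (intro tendsto_intros l null)
    then show ?thesis using le_limit[OF tendsto_const _ f_le] by simp
  qed
  moreover have "l \<le> w" if "\<And>t. f t \<le> w" for w
    using fG that by (intro le_limit[OF l tendsto_const]) (auto simp: s_def intro!: Sup_fin.boundedI)
  ultimately have "is_modulus z l" by (auto simp: is_modulus_def f_def)
  then show ?thesis ..
qed

lemma is_modulus_modulus: "is_modulus z (modulus z)"
  unfolding modulus_def
  by (rule theI', rule ex_ex1I[OF is_modulus_exists]) (meson antisym is_modulus_def)

lemma rotation_le_modulus: "re_part (cscale (cis t) z) \<le> modulus z"
  using is_modulus_modulus[of z] by (auto simp: is_modulus_def)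

lemma modulus_least: "(\<And>t. re_part (cscale (cis t) z) \<le> u) \<Longrightarrow> modulus z \<le> u"
  using is_modulus_modulus[of z] by (auto simp: is_modulus_def)

lemma abs_re_le_modulus: "\<bar>re_part z\<bar> \<le> modulus z"
  using rotation_le_modulus[of 0 z] rotation_le_modulus[of pi z] by (intro abs_leI) auto

lemma abs_im_le_modulus: "\<bar>im_part z\<bar> \<le> modulus z"
  using rotation_le_modulus[of "-pi/2" z] rotation_le_modulus[of "pi/2" z] by (intro abs_leI) auto

lemma modulus_nonneg [simp]: "0 \<le> modulus z"
  using order_trans[OF abs_ge_zero abs_re_le_modulus] .

lemma modulus_le_abs_add: "modulus z \<le> \<bar>re_part z\<bar> + \<bar>im_part z\<bar>"
proof (rule modulus_least)
  fix t
  have "cos t *\<^sub>R re_part z \<le> \<bar>cos t\<bar> *\<^sub>R \<bar>re_part z\<bar>" by (rule scaleR_le_abs)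
  also have "\<dots> \<le> 1 *\<^sub>R \<bar>re_part z\<bar>" by (intro scaleR_right_mono) auto
  finally have 1: "cos t *\<^sub>R re_part z \<le> \<bar>re_part z\<bar>" by simp
  have "(- sin t) *\<^sub>R im_part z \<le> \<bar>- sin t\<bar> *\<^sub>R \<bar>im_part z\<bar>" by (rule scaleR_le_abs)
  also have "\<dots> \<le> 1 *\<^sub>R \<bar>im_part z\<bar>" by (intro scaleR_right_mono) auto
  finally have 2: "(- sin t) *\<^sub>R im_part z \<le> \<bar>im_part z\<bar>" by simp
  show "re_part (cscale (cis t) z) \<le> \<bar>re_part z\<bar> + \<bar>im_part z\<bar>"
    using add_mono[OF 1 2] by simp
qed

lemma modulus_complexify [simp]: "modulus (complexify x) = \<bar>x\<bar>"
  using modulus_le_abs_add[of "complexify x"] abs_re_le_modulus[of "complexify x"]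
  by (intro antisym) auto

lemma modulus_triangle: "modulus (z + w) \<le> modulus z + modulus w"
proof (rule modulus_least)
  fix t
  show "re_part (cscale (cis t) (z + w)) \<le> modulus z + modulus w"
    using add_mono[OF rotation_le_modulus[of t z] rotation_le_modulus[of t w]]
    by (simp add: algebra_simps)
qed

lemma modulus_cscale_le: "modulus (cscale c z) \<le> cmod c *\<^sub>R modulus z"
proof (rule modulus_least)
  fix t
  have "cis t * c = of_real (cmod c) * cis (t + Arg c)"
    by (metis cis_mult mult.left_commute rcis_cmod_Arg rcis_def)
  then have "re_part (cscale (cis t) (cscale c z)) =
      cmod c *\<^sub>R re_part (cscale (cis (t + Arg c)) z)"
    by (simp only: cscale_cscale) (simp add: algebra_simps)
  also have "\<dots> \<le> cmod c *\<^sub>R modulus z"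
    by (intro scaleR_left_mono rotation_le_modulus) auto
  finally show "re_part (cscale (cis t) (cscale c z)) \<le> cmod c *\<^sub>R modulus z" .
qed

lemma modulus_cscale: "modulus (cscale c z) = cmod c *\<^sub>R modulus z"
proof (cases "c = 0")
  case True
  have "cscale 0 z = complexify 0" by (auto intro!: cplx_eqI)
  with True show ?thesis by simp
next
  case False
  have "modulus z = modulus (cscale (inverse c) (cscale c z))"
    using False by (simp add: cscale_cscale)
  also have "\<dots> \<le> cmod (inverse c) *\<^sub>R modulus (cscale c z)" by (rule modulus_cscale_le)
  finally have "cmod c *\<^sub>R modulus z \<le> cmod c *\<^sub>R (cmod (inverse c) *\<^sub>R modulus (cscale c z))"
    by (rule scaleR_left_mono) simp
  also have "\<dots> = modulus (cscale c z)" using False by (simp add: norm_inverse)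
  finally show ?thesis using modulus_cscale_le[of c z] by (intro antisym)
qed

instantiation complexification :: (banach_lattice) real_normed_vector
begin

definition "norm z = norm (modulus z)" for z :: "'a complexification"
definition "dist z w = norm (z - w)" for z w :: "'a complexification"
definition "sgn z = z /\<^sub>R norm z" for z :: "'a complexification"
definition uniformity_complexification :: "('a complexification \<times> 'a complexification) filter" where
  "uniformity_complexification = (INF e\<in>{0<..}. principal {(x, y). dist x y < e})"
definition open_complexification :: "'a complexification set \<Rightarrow> bool" where
  "open_complexification U \<longleftrightarrow>
     (\<forall>x\<in>U. eventually (\<lambda>(x', y). x' = x \<longrightarrow> y \<in> U) uniformity)"

lemma norm_re_part_le: "norm (re_part z) \<le> norm z" for z :: "'a complexification"
  using norm_mono_nonneg[OF abs_ge_zero abs_re_le_modulus[of z]] by (simp add: norm_complexification_def)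

lemma norm_im_part_le: "norm (im_part z) \<le> norm z" for z :: "'a complexification"
  using norm_mono_nonneg[OF abs_ge_zero abs_im_le_modulus[of z]] by (simp add: norm_complexification_def)

lemma norm_complexification_le: "norm z \<le> norm (re_part z) + norm (im_part z)"
  for z :: "'a complexification"
proof -
  have "norm z \<le> norm (\<bar>re_part z\<bar> + \<bar>im_part z\<bar>)"
    unfolding norm_complexification_def by (intro norm_mono_nonneg modulus_le_abs_add) simp
  also have "\<dots> \<le> norm \<bar>re_part z\<bar> + norm \<bar>im_part z\<bar>" by (rule norm_triangle_ineq)
  finally show ?thesis by simp
qed

instance
proof
  fix x y :: "'a complexification" and a b :: real
  show "dist x y = norm (x - y)" "sgn x = x /\<^sub>R norm x"
    by (simp_all add: dist_complexification_def sgn_complexification_def)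
  show "(uniformity :: ('a complexification \<times> 'a complexification) filter) =
      (INF e\<in>{0<..}. principal {(x, y). dist x y < e})"
    by (rule uniformity_complexification_def)
  show "open U \<longleftrightarrow> (\<forall>x\<in>U. eventually (\<lambda>(x', y). x' = x \<longrightarrow> y \<in> U) uniformity)"
    for U :: "'a complexification set"
    by (rule open_complexification_def)
  show "norm x = 0 \<longleftrightarrow> x = 0"
  proof
    assume "norm x = 0"
    then show "x = 0" using norm_re_part_le[of x] norm_im_part_le[of x] by (auto intro: cplx_eqI)
  next
    assume "x = 0"
    then show "norm x = 0" using norm_complexification_le[of x] by (simp add: norm_complexification_def)
  qed
  have "norm (x + y) \<le> norm (modulus x + modulus y)"
    unfolding norm_complexification_def by (intro norm_mono_nonneg modulus_triangle) simp
  also have "\<dots> \<le> norm x + norm y" by (simp add: norm_complexification_def norm_triangle_ineq)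
  finally show "norm (x + y) \<le> norm x + norm y" .
  show "norm (a *\<^sub>R x) = \<bar>a\<bar> * norm x"
    by (simp add: norm_complexification_def scaleR_complexification_eq_cscale modulus_cscale)
qed

end

instance complexification :: (banach_lattice) banach
proof
  fix X :: "nat \<Rightarrow> 'a complexification"
  assume C: "Cauchy X"
  have cauchy_part: "Cauchy (\<lambda>n. p (X n))"
    if p: "\<And>z w. p (z - w) = p z - p w" "\<And>z. norm (p z) \<le> norm z"
    for p :: "'a complexification \<Rightarrow> 'a"
  proof (rule CauchyI)
    fix e :: real assume "0 < e"
    then obtain M where M: "\<forall>m\<ge>M. \<forall>n\<ge>M. norm (X m - X n) < e"
      using CauchyD[OF C] by blast
    then show "\<exists>M. \<forall>m\<ge>M. \<forall>n\<ge>M. norm (p (X m) - p (X n)) < e"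
      by (metis le_less_trans p)
  qed
  obtain a where a: "(\<lambda>n. re_part (X n)) \<longlonglongrightarrow> a"
    using cauchy_part[of re_part] norm_re_part_le by (auto simp: Cauchy_convergent_iff convergent_def)
  obtain b where b: "(\<lambda>n. im_part (X n)) \<longlonglongrightarrow> b"
    using cauchy_part[of im_part] norm_im_part_le by (auto simp: Cauchy_convergent_iff convergent_def)
  have "(\<lambda>n. norm (re_part (X n) - a) + norm (im_part (X n) - b)) \<longlonglongrightarrow> 0 + 0"
    using a b by (intro tendsto_add) (simp_all add: LIM_zero_iff tendsto_norm_zero_iff)
  then have lim: "(\<lambda>n. norm (re_part (X n) - a) + norm (im_part (X n) - b)) \<longlonglongrightarrow> 0" by simp
  have "(\<lambda>n. X n - Cplx a b) \<longlonglongrightarrow> 0"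
    by (rule Lim_null_comparison[OF _ lim])
      (use norm_complexification_le[of "X n - Cplx a b" for n] in simp)
  then show "convergent X"
    by (auto simp: convergent_def LIM_zero_iff)
qed

lemma norm_cscale: "norm (cscale c z) = cmod c * norm z" for z :: "'a::banach_lattice complexification"
  by (simp add: norm_complexification_def modulus_cscale)

definition bounded_operator ::
  "('a::banach_lattice complexification \<Rightarrow> 'b::banach_lattice complexification) \<Rightarrow> bool" where
  "bounded_operator T \<longleftrightarrow> Vector_Spaces.linear cscale cscale T \<and> bounded_linear T"

definition dominates ::
  "('a::banach_lattice complexification \<Rightarrow> 'b::banach_lattice complexification) \<Rightarrow>
   ('a complexification \<Rightarrow> 'b complexification) \<Rightarrow> bool" where
  "dominates T S \<longleftrightarrow> (\<forall>x. complexify (modulus (S x)) \<le> T (complexify (modulus x)))"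

text \<open>A positive element of the complexification is a positive element of the real part, so the
  \<open>y \<in> E\<^sub>+\<close> below range over the real lattice \<open>'a\<close>.\<close>

definition d_nbhd :: "'a::banach_lattice \<Rightarrow> real \<Rightarrow> 'a complexification set" where
  "d_nbhd y e = {x. norm (inf (modulus x) y) < e}"

definition d_open :: "'a::banach_lattice complexification set \<Rightarrow> bool" where
  "d_open U \<longleftrightarrow> (\<forall>x\<in>U. \<exists>P. finite P \<and> P \<subseteq> {0..} \<times> {0<..} \<and>
     (\<lambda>v. x + v) ` (\<Inter>(y, e)\<in>P. d_nbhd y e) \<subseteq> U)"

definition d_topology :: "'a::banach_lattice complexification topology" where
  "d_topology = topology d_open"

lemma istopology_d_open: "istopology d_open"
  unfolding istopology_def
proof (intro conjI allI impI)
  fix U V :: "'a complexification set"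
  assume UV: "d_open U" "d_open V"
  show "d_open (U \<inter> V)"
    unfolding d_open_def
  proof
    fix x assume "x \<in> U \<inter> V"
    then have x: "x \<in> U" "x \<in> V" by simp_all
    obtain P where P: "finite P" "P \<subseteq> {0..} \<times> {0<..}"
      "(\<lambda>v. x + v) ` (\<Inter>(y, e)\<in>P. d_nbhd y e) \<subseteq> U"
      using UV(1) x(1) unfolding d_open_def by metis
    obtain Q where Q: "finite Q" "Q \<subseteq> {0..} \<times> {0<..}"
      "(\<lambda>v. x + v) ` (\<Inter>(y, e)\<in>Q. d_nbhd y e) \<subseteq> V"
      using UV(2) x(2) unfolding d_open_def by metis
    have "(\<Inter>(y, e)\<in>P \<union> Q. d_nbhd y e) \<subseteq> (\<Inter>(y, e)\<in>P. d_nbhd y e)"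
      "(\<Inter>(y, e)\<in>P \<union> Q. d_nbhd y e) \<subseteq> (\<Inter>(y, e)\<in>Q. d_nbhd y e)"
      by (rule INT_anti_mono; simp)+
    then have "(\<lambda>v. x + v) ` (\<Inter>(y, e)\<in>P \<union> Q. d_nbhd y e) \<subseteq> U \<inter> V"
      using P(3) Q(3) by (meson Int_greatest image_mono order_trans)
    then show "\<exists>P. finite P \<and> P \<subseteq> {0..} \<times> {0<..} \<and>
       (\<lambda>v. x + v) ` (\<Inter>(y, e)\<in>P. d_nbhd y e) \<subseteq> U \<inter> V"
      using P(1,2) Q(1,2) by (intro exI[of _ "P \<union> Q"]) simp
  qed
next
  fix K :: "'a complexification set set"
  assume "\<forall>U\<in>K. d_open U"
  then show "d_open (\<Union>K)" unfolding d_open_def by (meson Union_iff Union_upper order_trans)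
qed

lemma openin_d_topology: "openin d_topology = d_open"
  unfolding d_topology_def by (rule topology_inverse'[OF istopology_d_open])

definition relatively_d_compact :: "'a::banach_lattice complexification set \<Rightarrow> bool" where
  "relatively_d_compact A \<longleftrightarrow> compactin d_topology (d_topology closure_of A)"

definition d_compact_operator ::
  "('a::banach_lattice complexification \<Rightarrow> 'b::banach_lattice complexification) \<Rightarrow> bool" where
  "d_compact_operator T \<longleftrightarrow> (\<forall>A. bounded A \<longrightarrow> relatively_d_compact (T ` A))"

definition chi_set :: "'a::real_normed_vector set \<Rightarrow> real" where
  "chi_set A = Inf {\<delta>. 0 < \<delta> \<and> (\<exists>C. finite C \<and> A \<subseteq> (\<Union>c\<in>C. cball c \<delta>))}"

definition chi_op :: "('a::real_normed_vector \<Rightarrow> 'b::real_normed_vector) \<Rightarrow> real" where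
  "chi_op T = chi_set (T ` cball 0 1)"

end

(* If finitely many balls of radius r with centres c cover T B_E, then y = \<Sum> |c| satisfies
   ||(|S x| - y)\<^sup>+|| \<le> r on the unit ball, because |S x| \<le> T|x|. By d-compactness every S x has
   a small ||(|S x - s| \<and> y)|| for one of finitely many points s. Clipping both parts of s
   to [-y, y] gives a point w with |s - w| \<le> (|s| - y)\<^sup>+ and |w| \<le> 2y, whence
   |S x - w| \<le> (|S x| - y)\<^sup>+ + 3(|S x - s| \<and> y). So the finitely many points w are centres of
   balls of radius only slightly larger than r that cover S B_E. *)
theory Submission
  imports Defs
begin

section \<open>Modulus and truncation\<close>

lemma modulus_minus [simp]: "modulus (- z) = modulus z"
  for z :: "'a::banach_lattice complexification"
proof -
  have "- z = cscale (- 1) z" by (auto intro!: cplx_eqI)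
  then show ?thesis by (simp add: modulus_cscale)
qed

lemma modulus_diff_le: "modulus (z - w) \<le> modulus z + modulus w"
  for z w :: "'a::banach_lattice complexification"
  using modulus_triangle[of z "- w"] by simp

lemma modulus_minus_commute: "modulus (z - w) = modulus (w - z)"
  for z w :: "'a::banach_lattice complexification"
  using modulus_minus[of "z - w"] by simp

lemma modulus_le_modulus_diff: "modulus z \<le> modulus (z - w) + modulus w"
  for z w :: "'a::banach_lattice complexification"
  using modulus_triangle[of "z - w" w] by simp

text \<open>Homogeneity of the modulus, read on the embedded real part with a real scalar.\<close>

lemma abs_scaleR_abs: "\<bar>r\<bar> *\<^sub>R \<bar>x\<bar> = \<bar>r *\<^sub>R x\<bar>" for x :: "'a::banach_lattice"
  using modulus_cscale[of "complex_of_real r" "complexify x"] by (simp add: cscale_def)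

text \<open>The rotations by \<open>t\<close>, \<open>-t\<close>, \<open>pi - t\<close> and
  \<open>pi + t\<close> produce all four sign combinations of the two terms; joining over the signs
  gives the absolute values.\<close>

lemma rotation_abs_le_modulus:
  fixes z :: "'a::banach_lattice complexification"
  shows "\<bar>cos t\<bar> *\<^sub>R \<bar>re_part z\<bar> + \<bar>sin t\<bar> *\<^sub>R \<bar>im_part z\<bar> \<le> modulus z"
proof -
  define p where "p = cos t *\<^sub>R re_part z"
  define q where "q = sin t *\<^sub>R im_part z"
  have "p - q \<le> modulus z" "p + q \<le> modulus z" "- p - q \<le> modulus z" "- p + q \<le> modulus z"
    using rotation_le_modulus[of t z] rotation_le_modulus[of "- t" z]
      rotation_le_modulus[of "pi - t" z] rotation_le_modulus[of "pi + t" z]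
    by (simp_all add: p_def q_def cos_diff sin_diff cos_add sin_add)
  then have "p \<le> modulus z - q" "- p \<le> modulus z - q" "p \<le> modulus z + q" "- p \<le> modulus z + q"
    by (simp_all add: algebra_simps)
  then have "\<bar>p\<bar> \<le> modulus z - q" "\<bar>p\<bar> \<le> modulus z + q"
    by (auto intro: abs_leI)
  then have "q \<le> modulus z - \<bar>p\<bar>" "- q \<le> modulus z - \<bar>p\<bar>"
    by (simp_all add: algebra_simps)
  then have "\<bar>q\<bar> \<le> modulus z - \<bar>p\<bar>" by (rule abs_leI)
  then show ?thesis by (simp add: p_def q_def abs_scaleR_abs le_diff_eq add.commute)
qed

definition clip :: "'a::banach_lattice \<Rightarrow> 'a \<Rightarrow> 'a" where
  "clip y x = sup (- y) (inf x y)"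

lemma abs_clip_le: "0 \<le> y \<Longrightarrow> \<bar>clip y x\<bar> \<le> y"
  unfolding clip_def
  by (rule abs_leI) (auto simp: minus_le_iff intro: order_trans[of _ 0])

text \<open>For scalars the right side is the distance from \<open>x\<close> to the interval from
  \<open>-y\<close> to \<open>y\<close>. Without points: \<open>clip y x\<close> lies between
  \<open>x - m\<close> and \<open>x + m\<close>, where m is that right side.\<close>

lemma abs_diff_clip_le:
  assumes "0 \<le> y"
  shows "\<bar>x - clip y x\<bar> \<le> sup (\<bar>x\<bar> - y) 0"
proof (rule abs_leI)
  have "x - sup (\<bar>x\<bar> - y) 0 \<le> inf x y"
  proof (rule inf_greatest)
    show "x - sup (\<bar>x\<bar> - y) 0 \<le> x" by (simp only: diff_le_eq le_add_same_cancel1 sup_ge2)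
    have "x - y \<le> \<bar>x\<bar> - y" by (rule diff_right_mono) (rule abs_ge_self)
    also have "\<dots> \<le> sup (\<bar>x\<bar> - y) 0" by (rule sup_ge1)
    finally show "x - sup (\<bar>x\<bar> - y) 0 \<le> y" by (simp only: diff_le_eq add.commute)
  qed
  then have "x - sup (\<bar>x\<bar> - y) 0 \<le> clip y x"
    unfolding clip_def by (rule le_supI2)
  then show "x - clip y x \<le> sup (\<bar>x\<bar> - y) 0" by (simp only: diff_le_eq add.commute)
  have "- y - x \<le> \<bar>x\<bar> - y" using abs_ge_minus_self[of x] by (simp add: algebra_simps)
  then have "- y - x \<le> sup (\<bar>x\<bar> - y) 0" by (rule le_supI1)
  then have "- y \<le> x + sup (\<bar>x\<bar> - y) 0" by (simp only: diff_le_eq add.commute)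
  moreover have "inf x y \<le> x + sup (\<bar>x\<bar> - y) 0"
    by (rule le_infI1) (simp only: le_add_same_cancel1 sup_ge2)
  ultimately show "- (x - clip y x) \<le> sup (\<bar>x\<bar> - y) 0"
    unfolding clip_def minus_diff_eq diff_le_eq add.commute[of "sup (\<bar>x\<bar> - y) 0"]
    by (rule sup_least)
qed

text \<open>Squares of numbers in [0, 1] do not exceed the numbers. In the clipping estimate below
  this gives \<open>y\<close> a total weight of at least 1.\<close>

lemma one_le_abs_cos_add_abs_sin: "1 \<le> \<bar>cos t\<bar> + \<bar>sin t\<bar>" for t :: real
proof -
  have "(cos t)\<^sup>2 + (sin t)\<^sup>2 \<le> \<bar>cos t\<bar> + \<bar>sin t\<bar>"
    using power_decreasing[of 1 2 "\<bar>cos t\<bar>"] power_decreasing[of 1 2 "\<bar>sin t\<bar>"]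
    by (intro add_mono) simp_all
  then show ?thesis by simp
qed

lemma scaleR_le_of_le_one: "0 \<le> x \<Longrightarrow> r \<le> 1 \<Longrightarrow> r *\<^sub>R x \<le> x" for x :: "'a::banach_lattice"
  using scaleR_right_mono[of r 1 x] by simp

lemma scaleR_sup_zero_le: "0 \<le> r \<Longrightarrow> r *\<^sub>R sup x 0 \<le> sup (r *\<^sub>R x) 0"
  for x :: "'a::banach_lattice"
proof (cases "r = 0")
  case False
  moreover assume "0 \<le> r"
  ultimately have r: "0 < r" by simp
  have "sup x 0 \<le> sup (r *\<^sub>R x) 0 /\<^sub>R r"
    by (rule sup_least) (simp_all only: pos_le_divideR_eq[OF r] scaleR_zero_right sup_ge1 sup_ge2)
  then show ?thesis by (simp only: pos_le_divideR_eq[OF r])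
qed simp

text \<open>Pointwise, clipping is the projection onto a square containing the disc of radius \<open>y\<close>,
  so a point is at least as close to the square as to the disc.\<close>

lemma modulus_diff_clip_le:
  fixes z :: "'a::banach_lattice complexification"
  assumes y: "0 \<le> y"
  shows "modulus (z - Cplx (clip y (re_part z)) (clip y (im_part z))) \<le> sup (modulus z - y) 0"
proof (rule modulus_least)
  fix t :: real
  let ?m = "sup (modulus z - y) 0"
  let ?P = "\<bar>re_part z\<bar>" and ?Q = "\<bar>im_part z\<bar>"
  let ?a = "\<bar>cos t\<bar>" and ?b = "\<bar>sin t\<bar>"
  have bound: "r *\<^sub>R (x - clip y x) \<le> sup (\<bar>r\<bar> *\<^sub>R (\<bar>x\<bar> - y)) 0" for r and x :: 'a
    using scaleR_le_abs[of r "x - clip y x"]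
      scaleR_left_mono[OF abs_diff_clip_le[OF y], of "\<bar>r\<bar>" x] scaleR_sup_zero_le[of "\<bar>r\<bar>" "\<bar>x\<bar> - y"]
    by (meson abs_ge_zero order_trans)
  have single: "r *\<^sub>R (x - y) \<le> ?m" if "0 \<le> r" "r \<le> 1" "x \<le> modulus z" for r :: real and x :: 'a
  proof -
    have "r *\<^sub>R (x - y) \<le> r *\<^sub>R ?m"
      using that by (intro scaleR_left_mono le_supI1) simp_all
    also have "\<dots> \<le> ?m" using that by (intro scaleR_le_of_le_one) simp_all
    finally show ?thesis .
  qed
  \<comment> \<open>The case where both coordinates exceed \<open>y\<close>: the weighted
    coordinates stay below the modulus, and at least one full \<open>y\<close> is
    subtracted.\<close>
  have "?a *\<^sub>R (?P - y) + ?b *\<^sub>R (?Q - y) = (?a *\<^sub>R ?P + ?b *\<^sub>R ?Q) - (?a + ?b) *\<^sub>R y"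
    by (simp add: algebra_simps)
  also have "\<dots> \<le> modulus z - y"
    using rotation_abs_le_modulus[of t z] scaleR_right_mono[OF one_le_abs_cos_add_abs_sin[of t] y]
    by (intro diff_mono) simp_all
  also have "\<dots> \<le> ?m" by simp
  finally have both: "?a *\<^sub>R (?P - y) + ?b *\<^sub>R (?Q - y) \<le> ?m" .
  \<comment> \<open>Distributing the sum over the two suprema leaves four terms: both excesses
    together (\<open>both\<close>), each one alone (\<open>single\<close>), and 0.\<close>
  have "sup (?a *\<^sub>R (?P - y)) 0 + sup (?b *\<^sub>R (?Q - y)) 0 \<le> ?m"
    unfolding add_sup_distrib_left add_sup_distrib_right
    using both single[of ?a ?P] single[of ?b ?Q] abs_re_le_modulus[of z] abs_im_le_modulus[of z]
    by simp
  then have "cos t *\<^sub>R (re_part z - clip y (re_part z)) + (- sin t) *\<^sub>R (im_part z - clip y (im_part z)) \<le> ?m"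
    using add_mono[OF bound[of "cos t" "re_part z"] bound[of "- sin t" "im_part z"]]
    by (simp only: abs_minus_cancel)
  then show "re_part (cscale (cis t) (z - Cplx (clip y (re_part z)) (clip y (im_part z)))) \<le> ?m"
    by simp
qed

lemma sup_diff_zero_le_add:
  fixes a b y :: "'a::banach_lattice"
  assumes "a \<le> d + b" "0 \<le> d"
  shows "sup (a - y) 0 \<le> d + sup (b - y) 0"
proof (rule sup_least)
  have "a - y \<le> d + (b - y)" using assms(1) by (simp add: algebra_simps)
  also have "\<dots> \<le> d + sup (b - y) 0" by (rule add_left_mono) simp
  finally show "a - y \<le> d + sup (b - y) 0" .
  show "0 \<le> d + sup (b - y) 0" using assms(2) by simp
qed

text \<open>After subtracting the excess of \<open>z\<close> over \<open>y\<close>, the distance to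
  the clipped \<open>s\<close> is bounded both by a multiple of \<open>modulus (z - s)\<close> and
  by a multiple of \<open>y\<close>, hence by their infimum. One \<open>w\<close> serves all
  \<open>z\<close>, so finitely many \<open>s\<close> give finitely many centres.\<close>

lemma exists_truncation:
  fixes s :: "'a::banach_lattice complexification"
  assumes y: "0 \<le> y"
  obtains w where
    "\<And>z. modulus (z - w) \<le> sup (modulus z - y) 0 + 3 *\<^sub>R inf (modulus (z - s)) y"
proof
  define w where "w = Cplx (clip y (re_part s)) (clip y (im_part s))"
  fix z
  let ?m = "sup (modulus z - y) 0" and ?d = "modulus (z - s)"
  have "modulus (z - w) \<le> ?d + modulus (s - w)"
    using modulus_triangle[of "z - s" "s - w"] by simp
  also have "modulus (s - w) \<le> sup (modulus s - y) 0"
    unfolding w_def by (rule modulus_diff_clip_le[OF y])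
  also have "\<dots> \<le> ?d + ?m"
    using modulus_le_modulus_diff[of s z]
    by (intro sup_diff_zero_le_add) (simp_all add: modulus_minus_commute)
  finally have "modulus (z - w) \<le> ?d + (?d + ?m)" by simp
  also have "\<dots> = ?m + 2 *\<^sub>R ?d" by (simp add: scaleR_2)
  \<comment> \<open>The factor 2 is raised to 3 to match the second bound, where |z| contributes one
    \<open>y\<close> beyond its excess and |w| two more.\<close>
  also have "\<dots> \<le> ?m + 3 *\<^sub>R ?d" by (intro add_left_mono scaleR_right_mono) simp_all
  finally have 1: "modulus (z - w) - ?m \<le> 3 *\<^sub>R ?d" by (simp only: diff_le_eq add.commute)
  have "modulus w \<le> y + y"
    using modulus_le_abs_add[of w] add_mono[OF abs_clip_le[OF y, of "re_part s"] abs_clip_le[OF y, of "im_part s"]]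
    by (simp add: w_def)
  then have "modulus (z - w) \<le> modulus z + (y + y)"
    using modulus_diff_le[of z w] by (meson add_left_mono order_trans)
  also have "\<dots> = (modulus z - y) + 3 *\<^sub>R y"
    using scaleR_left_distrib[of 1 2 y] by (simp add: scaleR_2 algebra_simps)
  also have "\<dots> \<le> ?m + 3 *\<^sub>R y" by (intro add_right_mono) simp
  finally have 2: "modulus (z - w) - ?m \<le> 3 *\<^sub>R y" by (simp only: diff_le_eq add.commute)
  have "(modulus (z - w) - ?m) /\<^sub>R 3 \<le> inf ?d y"
    using 1 2 by (intro inf_greatest) (simp_all only: pos_divideR_le_eq zero_less_numeral)
  then have "modulus (z - w) - ?m \<le> 3 *\<^sub>R inf ?d y"
    by (simp only: pos_divideR_le_eq zero_less_numeral)
  then show "modulus (z - w) \<le> ?m + 3 *\<^sub>R inf ?d y" by (simp only: diff_le_eq add.commute)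
qed

section \<open>The d-topology\<close>

text \<open>The right side expands to an infimum of four sums, each above \<open>a + b\<close> or
  above \<open>y\<close>. This is the triangle inequality behind the d-topology.\<close>

lemma inf_add_le:
  fixes a b y :: "'a::banach_lattice"
  assumes "0 \<le> a" "0 \<le> b" "0 \<le> y"
  shows "inf (a + b) y \<le> inf a y + inf b y"
  unfolding add_inf_distrib_left add_inf_distrib_right
  using assms by (auto intro: le_infI1 le_infI2 add_increasing add_increasing2)

text \<open>Truncation at \<open>y\<close> is subadditive, so a basic neighbourhood contains a
  smaller one around each of its points. Openness lets these sets enter compactness covers.\<close>

lemma d_open_d_nbhd:
  fixes s :: "'a::banach_lattice complexification"
  assumes y: "0 \<le> y"
  shows "d_open {z. z - s \<in> d_nbhd y e}"
  unfolding d_open_def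
proof
  fix z assume "z \<in> {z. z - s \<in> d_nbhd y e}"
  then have z: "norm (inf (modulus (z - s)) y) < e" by (simp add: d_nbhd_def)
  \<comment> \<open>The slack left at \<open>z\<close>; the same \<open>y\<close> is kept, so one
    pair suffices.\<close>
  let ?e = "e - norm (inf (modulus (z - s)) y)"
  have "z + v - s \<in> d_nbhd y e" if v: "v \<in> d_nbhd y ?e" for v
  proof -
    have "inf (modulus (z + v - s)) y \<le> inf (modulus (z - s) + modulus v) y"
      using modulus_triangle[of "z - s" v] by (intro inf_mono) (simp_all add: algebra_simps)
    also have "\<dots> \<le> inf (modulus (z - s)) y + inf (modulus v) y"
      using y by (intro inf_add_le) simp_all
    finally have "norm (inf (modulus (z + v - s)) y) \<le>
        norm (inf (modulus (z - s)) y + inf (modulus v) y)"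
      using y by (intro norm_mono_nonneg) simp_all
    also have "\<dots> \<le> norm (inf (modulus (z - s)) y) + norm (inf (modulus v) y)"
      by (rule norm_triangle_ineq)
    also have "\<dots> < e" using v by (simp add: d_nbhd_def)
    finally show ?thesis by (simp add: d_nbhd_def)
  qed
  then show "\<exists>P. finite P \<and> P \<subseteq> {0..} \<times> {0<..} \<and>
      (\<lambda>v. z + v) ` (\<Inter>(y, e)\<in>P. d_nbhd y e) \<subseteq> {z. z - s \<in> d_nbhd y e}"
    using y z by (intro exI[of _ "{(y, ?e)}"]) auto
qed

text \<open>The compact closure is covered by the open translates centred at its own points. The net
  \<open>F\<close> is taken from the closure, not from \<open>A\<close>.\<close>

lemma relatively_d_compact_finite_net:
  fixes A :: "'a::banach_lattice complexification set"
  assumes A: "relatively_d_compact A" and y: "0 \<le> y" and e: "0 < e"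
  obtains F where "finite F" "\<And>z. z \<in> A \<Longrightarrow> \<exists>s\<in>F. z - s \<in> d_nbhd y e"
proof -
  let ?U = "\<lambda>s. {z. z - s \<in> d_nbhd y e}"
  have zero: "s \<in> ?U s" for s
  proof -
    have "modulus (0::'a complexification) = 0"
      by (metis abs_0_eq modulus_complexify zero_complexification_def)
    then show ?thesis using y e by (simp add: d_nbhd_def inf_absorb1)
  qed
  \<comment> \<open>\<open>closure_of_subset\<close> asks for \<open>A\<close> to lie in the
    topspace.\<close>
  have "d_open (UNIV :: 'a complexification set)" unfolding d_open_def by auto
  then have top: "topspace d_topology = (UNIV :: 'a complexification set)"
    by (metis openin_d_topology openin_subset top.extremum_uniqueI)
  let ?K = "d_topology closure_of A"
  have AK: "A \<subseteq> ?K" by (rule closure_of_subset) (simp add: top)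
  obtain \<F> where \<F>: "finite \<F>" "\<F> \<subseteq> ?U ` ?K" "?K \<subseteq> \<Union>\<F>"
  proof -
    have "compactin d_topology ?K" using A by (simp add: relatively_d_compact_def)
    moreover have "openin d_topology U" if "U \<in> ?U ` ?K" for U
      using that d_open_d_nbhd[OF y] by (auto simp: openin_d_topology)
    moreover have "?K \<subseteq> \<Union> (?U ` ?K)" using zero by blast
    ultimately have "\<exists>\<F>. finite \<F> \<and> \<F> \<subseteq> ?U ` ?K \<and> ?K \<subseteq> \<Union>\<F>" by (rule compactinD)
    then show thesis using that by blast
  qed
  obtain F where F: "F \<subseteq> ?K" "finite F" "\<F> = ?U ` F"
    using finite_subset_image[OF \<F>(1,2)] by blast
  show ?thesis
  proof
    show "finite F" by (rule F(2))
    show "\<exists>s\<in>F. z - s \<in> d_nbhd y e" if "z \<in> A" for z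
      using that AK \<F>(3) F(3) by blast
  qed
qed

section \<open>Covers by balls\<close>

text \<open>If \<open>c\<close> is a centre near T|x|, then |Sx| is at most |T|x| - c| + |c|, and
  |c| is absorbed by the sum. That sum is independent of \<open>x\<close>.\<close>

lemma dominated_excess_le:
  fixes S T :: "'a::banach_lattice complexification \<Rightarrow> 'b::banach_lattice complexification"
  assumes dom: "dominates T S"
    and C: "finite C" "T ` cball 0 1 \<subseteq> (\<Union>c\<in>C. cball c r)"
    and x: "x \<in> cball 0 1"
  shows "norm (sup (modulus (S x) - (\<Sum>c\<in>C. modulus c)) 0) \<le> r"
proof -
  let ?x = "complexify (modulus x)"
  have "?x \<in> cball 0 1" using x by (simp add: norm_complexification_def)
  then obtain c where c: "c \<in> C" "norm (T ?x - c) \<le> r"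
    using C(2) by (fastforce simp: dist_norm norm_minus_commute)
  have "modulus (S x) \<le> re_part (T ?x)"
    using dom by (simp add: dominates_def less_eq_complexification_def)
  also have "\<dots> \<le> modulus (T ?x)" using abs_re_le_modulus abs_ge_self order_trans by blast
  also have "\<dots> \<le> modulus (T ?x - c) + modulus c" by (rule modulus_le_modulus_diff)
  also have "\<dots> \<le> modulus (T ?x - c) + (\<Sum>c\<in>C. modulus c)"
    using C(1) c(1) sum_mono2[of C "{c}" modulus] by (intro add_left_mono) simp
  finally have "sup (modulus (S x) - (\<Sum>c\<in>C. modulus c)) 0 \<le> modulus (T ?x - c)"
    by (simp add: algebra_simps)
  then have "norm (sup (modulus (S x) - (\<Sum>c\<in>C. modulus c)) 0) \<le> norm (modulus (T ?x - c))"
    by (rule norm_mono_nonneg[rotated]) simp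
  then show ?thesis using c(2) by (simp add: norm_complexification_def)
qed

lemma dominated_cover:
  fixes S T :: "'a::banach_lattice complexification \<Rightarrow> 'b::banach_lattice complexification"
  assumes dom: "dominates T S" and S: "d_compact_operator S"
    and C: "finite C" "T ` cball 0 1 \<subseteq> (\<Union>c\<in>C. cball c r)"
    and e: "0 < e"
  obtains D where "finite D" "S ` cball 0 1 \<subseteq> (\<Union>w\<in>D. cball w (r + e))"
proof -
  define y where "y = (\<Sum>c\<in>C. modulus c)"
  have y: "0 \<le> y" unfolding y_def by (rule sum_nonneg) simp
  have "relatively_d_compact (S ` cball 0 1)" using S by (simp add: d_compact_operator_def)
  \<comment> \<open>The tolerance \<open>e / 3\<close> offsets the factor 3 in the truncation
    estimate.\<close>
  then obtain F where F: "finite F" "\<And>z. z \<in> S ` cball 0 1 \<Longrightarrow> \<exists>s\<in>F. z - s \<in> d_nbhd y (e / 3)"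
    using relatively_d_compact_finite_net[OF _ y, of _ "e / 3"] e by auto
  have "\<exists>w. \<forall>z. modulus (z - w) \<le> sup (modulus z - y) 0 + 3 *\<^sub>R inf (modulus (z - s)) y" for s :: "'b complexification"
    using exists_truncation[OF y, of s] by blast
  then obtain w :: "'b complexification \<Rightarrow> 'b complexification" where w:
    "\<And>s z. modulus (z - w s) \<le> sup (modulus z - y) 0 + 3 *\<^sub>R inf (modulus (z - s)) y"
    by metis
  show ?thesis
  proof
    show "finite (w ` F)" using F(1) by simp
    show "S ` cball 0 1 \<subseteq> (\<Union>w\<in>w ` F. cball w (r + e))"
    proof
      fix z assume z: "z \<in> S ` cball 0 1"
      then obtain s where s: "s \<in> F" "norm (inf (modulus (z - s)) y) < e / 3"
        using F(2) by (auto simp: d_nbhd_def)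
      have "norm (z - w s) \<le> norm (sup (modulus z - y) 0 + 3 *\<^sub>R inf (modulus (z - s)) y)"
        unfolding norm_complexification_def by (intro norm_mono_nonneg w modulus_nonneg)
      also have "\<dots> \<le> norm (sup (modulus z - y) 0) + 3 * norm (inf (modulus (z - s)) y)"
        using norm_triangle_ineq[of "sup (modulus z - y) 0" "3 *\<^sub>R inf (modulus (z - s)) y"] by simp
      also have "\<dots> \<le> r + e"
        using z s(2) dominated_excess_le[OF dom C] by (auto simp: y_def intro!: add_mono)
      finally show "z \<in> (\<Union>w\<in>w ` F. cball w (r + e))"
        using s(1) by (auto simp: dist_norm norm_minus_commute)
    qed
  qed
qed

theorem proposition19:
  fixes S T :: "'a::banach_lattice complexification \<Rightarrow> 'b::banach_lattice complexification"
  assumes "bounded_operator S" "bounded_operator T"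
    and "dominates T S"
    and "d_compact_operator S"
  shows "chi_op S \<le> chi_op T"
  unfolding chi_op_def chi_set_def[of "T ` cball 0 1"]
proof (rule cInf_greatest)
  \<comment> \<open>Boundedness of \<open>T\<close> supplies an admissible radius, so the infimum
    defining \<open>chi_op T\<close> is over a nonempty set.\<close>
  have "bounded (T ` cball 0 1)"
    using assms(2) by (simp add: bounded_operator_def bounded_linear_image)
  then obtain b where "0 < b" "T ` cball 0 1 \<subseteq> cball 0 b"
    using bounded_subset_ballD by (meson ball_subset_cball order_trans)
  then show "{\<delta>. 0 < \<delta> \<and> (\<exists>C. finite C \<and> T ` cball 0 1 \<subseteq> (\<Union>c\<in>C. cball c \<delta>))} \<noteq> {}"
    by (auto intro!: exI[of _ b] exI[of _ "{0}"])
next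
  fix r assume "r \<in> {\<delta>. 0 < \<delta> \<and> (\<exists>C. finite C \<and> T ` cball 0 1 \<subseteq> (\<Union>c\<in>C. cball c \<delta>))}"
  then obtain C where r: "0 < r" and C: "finite C" "T ` cball 0 1 \<subseteq> (\<Union>c\<in>C. cball c r)" by auto
  \<comment> \<open>The cover of the image under \<open>S\<close> exists only with radius
    \<open>r + e\<close>, so \<open>e\<close> is sent to 0.\<close>
  show "chi_set (S ` cball 0 1) \<le> r"
  proof (rule field_le_epsilon)
    fix e :: real assume e: "0 < e"
    obtain D where D: "finite D" "S ` cball 0 1 \<subseteq> (\<Union>w\<in>D. cball w (r + e))"
      using dominated_cover[OF assms(3,4) C e] by blast
    show "chi_set (S ` cball 0 1) \<le> r + e"
      unfolding chi_set_def
      using r e D by (intro cInf_lower bdd_belowI[of _ 0]) auto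
  qed
qed

end
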